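(* Let $b\in C^1(\mathbb R)$ have bounded derivative and assume that there exists $\mathfrak m_b>0$ such that $b'(x)\leqslant-\mathfrak m_b$ for every $x\in\mathbb R$. Let $X$ be the stationary solution of $X_t=X_0+\int_0^tb(X_s)\,ds+\sigma B_t$, $t\in\mathbb R_+$, let $f$ be the density of $X_0$, and assume that $f\in\mathbb L^2(\mathbb R,dr)$. Consider a set $\mathcal F$ of Lipschitz continuous functions from $\mathbb R$ into $\mathbb R$ such that $$\mathfrak c_{\mathcal F}:=\sup_{\varphi\in\mathcal F}\|\varphi\|_{\rm Lip}<\infty.$$ For every $\varphi\in\mathcal F$, consider the empirical process $$\nu_n(\varphi):=\frac1n\sum_{i=1}^n[\varphi(X_{t_i})-\mathfrak m(\varphi)]\quad\text{with}\quad\mathfrak m(\varphi):=\langle\varphi,f\rangle=\int\varphi(x)f(x)\,dx.$$ Then, for every $$\mathfrak h\geqslant\mathbb E\left(\sup_{\varphi\in\mathcal F}|\nu_n(\varphi)|\right)$$ and every $r>0$, $$\mathbb P\left(\sup_{\varphi\in\mathcal F}|\nu_n(\varphi)|-\mathfrak h>r\right)\leqslant\exp\left(-\frac{r^2}{\mathfrak c\,\mathfrak c_{\mathcal F}^2}(n\Delta_n)^{\mathfrak b_H}\right),$$ where $\mathfrak c$ is the constant of the concentration inequality recalled in the context.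
   Context: Equation and sampling. $B=(B_t)_{t\in\mathbb R_+}$ is a fractional Brownian motion of Hurst index $H\in(0,1)$ and $\sigma\in\mathbb R\setminus\{0\}$. Under the stated conditions on $b$ ($b\in C^1(\mathbb R)$, $b'$ bounded, $b'\leqslant-\mathfrak m_b<0$), it is known that the equation $X_t=X_0+\int_0^tb(X_s)ds+\sigma B_t$ has a unique stationary solution $X=(X_t)_{t\in\mathbb R_+}$ (in particular $X_t$ has the same distribution as $X_0$ for every $t$), and that $X_0$ has a density $f$ with respect to Lebesgue's measure. The process is observed at times $t_i:=i\Delta_n$, $i\in\{1,\dots,n\}$, where $\Delta_n>0$, $\lim_{n\to\infty}\Delta_n=0$ and $\lim_{n\to\infty}n\Delta_n=\infty$. Put $\mathfrak a_H:=(2H)\vee1$ and $\mathfrak b_H:=1\wedge(2-2H)$. Known concentration inequality (defining the constant $\mathfrak c$). $\mathbb R^n$ is equipped with the distance $d_1(\mathbf x,\mathbf y)=\sum_{i=1}^n|\mathbf y_i-\mathbf x_i|$, and $\|\cdot\|_{\rm Lip}$ denotes the Lipschitz semi-norm (best Lipschitz constant). Under the stated conditions on $b$ it is known (Bertin, Klutchnikoff, Panloup and Varvenne) that there exists a constant $\mathfrak c>0$, not depending on $n$, such that for every Lipschitz map $F:(\mathbb R^n,d_1)\to\mathbb R$ and every $r>0$, $$\mathbb P(F(X_{t_1},\dots,X_{t_n})-\mathbb E(F(X_{t_1},\dots,X_{t_n}))>r)\leqslant\exp\left(-\frac{r^2}{\mathfrak c\|F\|_{\rm Lip}^2n^{\mathfrak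 a_H}\Delta_n^{-\mathfrak b_H}}\right)$$ (the right-hand side being read as $0$ if $\|F\|_{\rm Lip}=0$; likewise the bound in the claim is read as $0$ if $\mathfrak c_{\mathcal F}=0$). Such a constant $\mathfrak c$ is fixed. *)

theory Defs
  imports "HOL-Probability.Probability"
begin

text \<open>The best Lipschitz constant; it is only meaningful for maps satisfying
  \<^const>\<open>Lipschitz_continuous_map\<close>, for which the set below is nonempty.\<close>

definition Lip_seminorm :: "'a metric \<Rightarrow> 'b metric \<Rightarrow> ('a \<Rightarrow> 'b) \<Rightarrow> real" where
  "Lip_seminorm m1 m2 g =
     Inf {L. 0 \<le> L \<and> (\<forall>x\<in>mspace m1. \<forall>y\<in>mspace m1. mdist m2 (g x) (g y) \<le> L * mdist m1 x y)}"

text \<open>The \<open>n\<close>-dimensional real space with coordinates indexed by \<open>{1..n}\<close>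
  and the distance \<open>d\<^sub>1\<close>.\<close>

definition d1_metric :: "nat \<Rightarrow> (nat \<Rightarrow> real) metric" where
  "d1_metric n = metric ({1..n} \<rightarrow>\<^sub>E UNIV, \<lambda>x y. \<Sum>i=1..n. \<bar>y i - x i\<bar>)"

lemma Metric_space_d1:
  "Metric_space ({1..n::nat} \<rightarrow>\<^sub>E (UNIV :: real set)) (\<lambda>x y. \<Sum>i=1..n. \<bar>y i - x i\<bar>)"
proof
  fix x y :: "nat \<Rightarrow> real"
  show "0 \<le> (\<Sum>i=1..n. \<bar>y i - x i\<bar>)"
    by (simp add: sum_nonneg)
  show "(\<Sum>i=1..n. \<bar>y i - x i\<bar>) = (\<Sum>i=1..n. \<bar>x i - y i\<bar>)"
    by (simp add: abs_minus_commute)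
next
  fix x y :: "nat \<Rightarrow> real"
  assume xy: "x \<in> {1..n} \<rightarrow>\<^sub>E UNIV" "y \<in> {1..n} \<rightarrow>\<^sub>E UNIV"
  show "((\<Sum>i=1..n. \<bar>y i - x i\<bar>) = 0) = (x = y)"
  proof
    assume "(\<Sum>i=1..n. \<bar>y i - x i\<bar>) = 0"
    then have "\<And>i. i \<in> {1..n} \<Longrightarrow> x i = y i"
      by (subst (asm) sum_nonneg_eq_0_iff) auto
    then show "x = y"
      using xy by (rule_tac PiE_ext) auto
  qed simp
next
  fix x y z :: "nat \<Rightarrow> real"
  show "(\<Sum>i=1..n. \<bar>z i - x i\<bar>) \<le> (\<Sum>i=1..n. \<bar>y i - x i\<bar>) + (\<Sum>i=1..n. \<bar>z i - y i\<bar>)"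
    unfolding sum.distrib[symmetric] by (rule sum_mono) linarith
qed

lemma mspace_d1_metric [simp]: "mspace (d1_metric n) = {1..n} \<rightarrow>\<^sub>E UNIV"
  unfolding d1_metric_def by (rule Metric_space.mspace_metric[OF Metric_space_d1])

lemma mdist_d1_metric [simp]: "mdist (d1_metric n) x y = (\<Sum>i=1..n. \<bar>y i - x i\<bar>)"
  unfolding d1_metric_def by (simp only: Metric_space.mdist_metric[OF Metric_space_d1])

definition gaussian_rv :: "'a measure \<Rightarrow> ('a \<Rightarrow> real) \<Rightarrow> bool" where
  "gaussian_rv M Y \<longleftrightarrow>
     Y \<in> borel_measurable M \<and>
     ((\<exists>\<mu> s. 0 < s \<and> distributed M lborel Y (normal_density \<mu> s)) \<or>
      (\<exists>\<mu>. AE \<omega> in M. Y \<omega> = \<mu>))"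

text \<open>Processes are indexed by \<^typ>\<open>real\<close>, but only their values at times \<open>t \<ge> 0\<close> matter.\<close>

definition gaussian_process :: "'a measure \<Rightarrow> (real \<Rightarrow> 'a \<Rightarrow> real) \<Rightarrow> bool" where
  "gaussian_process M B \<longleftrightarrow>
     (\<forall>I a. finite I \<longrightarrow> I \<subseteq> {0..} \<longrightarrow> gaussian_rv M (\<lambda>\<omega>. \<Sum>t\<in>I. a t * B t \<omega>))"

definition fractional_brownian_motion ::
    "'a measure \<Rightarrow> real \<Rightarrow> (real \<Rightarrow> 'a \<Rightarrow> real) \<Rightarrow> bool" where
  "fractional_brownian_motion M H B \<longleftrightarrow>
     gaussian_process M B \<and>
     (\<forall>t\<ge>0. (\<integral>\<omega>. B t \<omega> \<partial>M) = 0) \<and>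
     (\<forall>s\<ge>0. \<forall>t\<ge>0. (\<integral>\<omega>. B s \<omega> * B t \<omega> \<partial>M)
        = (s powr (2 * H) + t powr (2 * H) - \<bar>t - s\<bar> powr (2 * H)) / 2) \<and>
     (AE \<omega> in M. continuous_on {0..} (\<lambda>t. B t \<omega>))"

definition stationary_process :: "'a measure \<Rightarrow> (real \<Rightarrow> 'a \<Rightarrow> real) \<Rightarrow> bool" where
  "stationary_process M X \<longleftrightarrow>
     (\<forall>t\<ge>0. X t \<in> borel_measurable M) \<and>
     (\<forall>I u. finite I \<longrightarrow> I \<subseteq> {0..} \<longrightarrow> 0 \<le> u \<longrightarrow>
        distr M (Pi\<^sub>M I (\<lambda>_. borel)) (\<lambda>\<omega>. \<lambda>t\<in>I. X (t + u) \<omega>)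
        = distr M (Pi\<^sub>M I (\<lambda>_. borel)) (\<lambda>\<omega>. \<lambda>t\<in>I. X t \<omega>))"

definition solves_sde ::
    "'a measure \<Rightarrow> (real \<Rightarrow> real) \<Rightarrow> real \<Rightarrow> (real \<Rightarrow> 'a \<Rightarrow> real) \<Rightarrow> (real \<Rightarrow> 'a \<Rightarrow> real) \<Rightarrow> bool" where
  "solves_sde M b \<sigma> B X \<longleftrightarrow>
     (\<forall>t\<ge>0. X t \<in> borel_measurable M) \<and>
     (AE \<omega> in M. continuous_on {0..} (\<lambda>t. X t \<omega>) \<and>
        (\<forall>t\<ge>0. X t \<omega> = X 0 \<omega> + (LBINT s:{0..t}. b (X s \<omega>)) + \<sigma> * B t \<omega>))"

definition aH :: "real \<Rightarrow> real" where "aH H = max (2 * H) 1"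

definition bH :: "real \<Rightarrow> real" where "bH H = min 1 (2 - 2 * H)"

text \<open>The case distinction is needed because \<open>x / 0 = 0\<close>, so that the exponential would be
  \<open>1\<close> for a vanishing semi-norm, whereas it is to be read as \<open>0\<close>.\<close>

definition concentration_constant ::
    "'a measure \<Rightarrow> (real \<Rightarrow> 'a \<Rightarrow> real) \<Rightarrow> real \<Rightarrow> (nat \<Rightarrow> real) \<Rightarrow> real \<Rightarrow> bool" where
  "concentration_constant M X H \<Delta> c \<longleftrightarrow>
     0 < c \<and>
     (\<forall>n\<ge>1. \<forall>G r.
        Lipschitz_continuous_map (d1_metric n) euclidean_metric G \<longrightarrow> 0 < r \<longrightarrow>
        (let Z = (\<lambda>\<omega>. G (\<lambda>i\<in>{1..n}. X (real i * \<Delta> n) \<omega>));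
             L = Lip_seminorm (d1_metric n) euclidean_metric G
         in measure M {\<omega> \<in> space M. Z \<omega> - (\<integral>\<omega>'. Z \<omega>' \<partial>M) > r}
            \<le> (if L = 0 then 0
                else exp (- (r\<^sup>2 / (c * L\<^sup>2 * real n powr aH H * \<Delta> n powr (- bH H)))))))"

definition mean_wrt :: "(real \<Rightarrow> real) \<Rightarrow> (real \<Rightarrow> real) \<Rightarrow> real" where
  "mean_wrt f \<phi> = (\<integral>x. \<phi> x * f x \<partial>lborel)"

definition empirical_process ::
    "(real \<Rightarrow> real) \<Rightarrow> (real \<Rightarrow> 'a \<Rightarrow> real) \<Rightarrow> (nat \<Rightarrow> real) \<Rightarrow> nat \<Rightarrow> (real \<Rightarrow> real) \<Rightarrow> 'a \<Rightarrow> real" where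
  "empirical_process f X \<Delta> n \<phi> \<omega> =
     1 / real n * (\<Sum>i=1..n. \<phi> (X (real i * \<Delta> n) \<omega>) - mean_wrt f \<phi>)"

text \<open>Suprema of nonnegative quantities are taken in \<^typ>\<open>ennreal\<close>, so that they are
  meaningful without boundedness assumptions and equal \<open>0\<close> over the empty class.\<close>

definition sup_empirical_process ::
    "(real \<Rightarrow> real) \<Rightarrow> (real \<Rightarrow> 'a \<Rightarrow> real) \<Rightarrow> (nat \<Rightarrow> real) \<Rightarrow> nat \<Rightarrow> (real \<Rightarrow> real) set \<Rightarrow> 'a \<Rightarrow> ennreal" where
  "sup_empirical_process f X \<Delta> n \<F> \<omega> = (SUP \<phi>\<in>\<F>. ennreal \<bar>empirical_process f X \<Delta> n \<phi> \<omega>\<bar>)"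

definition Lip_sup :: "(real \<Rightarrow> real) set \<Rightarrow> ennreal" where
  "Lip_sup \<F> = (SUP \<phi>\<in>\<F>. ennreal (Lip_seminorm euclidean_metric euclidean_metric \<phi>))"

text \<open>The class may be uncountable, but the supremum is still a random variable, as a lower
  semicontinuous function of the observations.\<close>

lemma sup_empirical_process_measurable:
  assumes X: "\<And>t. 0 \<le> t \<Longrightarrow> X t \<in> borel_measurable M" and \<Delta>: "0 \<le> \<Delta> n"
    and \<F>: "\<And>\<phi>. \<phi> \<in> \<F> \<Longrightarrow> Lipschitz_continuous_map euclidean_metric euclidean_metric \<phi>"
  shows "sup_empirical_process f X \<Delta> n \<F> \<in> borel_measurable M"
proof (rule borel_measurableI_greater)
  fix a :: ennreal
  define V where "V \<omega> i = (if i \<in> {1..n} then X (real i * \<Delta> n) \<omega> else 0)" for \<omega> i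
  define S where
    "S \<phi> v = ennreal \<bar>1 / real n * (\<Sum>i=1..n. \<phi> (v i) - mean_wrt f \<phi>)\<bar>"
    for \<phi> and v :: "nat \<Rightarrow> real"
  define U where "U = (\<Union>\<phi>\<in>\<F>. {v. a < S \<phi> v})"
  have "V \<in> borel_measurable M"
    by (rule measurable_coordinatewise_then_product) (use X \<Delta> in \<open>auto simp: V_def\<close>)
  moreover have "open U"
    unfolding U_def
  proof (intro open_UN ballI)
    fix \<phi> assume "\<phi> \<in> \<F>"
    then have "continuous_on UNIV \<phi>"
      using Lipschitz_continuous_imp_continuous_map[OF \<F>] by fastforce
    then have "continuous_on UNIV (\<lambda>v::nat\<Rightarrow>real. \<phi> (v i))" for i
      by (rule continuous_on_compose2) (auto intro: continuous_on_product_coordinates)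
    then have "continuous_on UNIV (S \<phi>)"
      unfolding S_def by (intro continuous_on_ennreal continuous_intros)
    then show "open {v. a < S \<phi> v}"
      by (intro open_Collect_less) auto
  qed
  ultimately have "V -` U \<inter> space M \<in> sets M"
    by (intro measurable_sets[where A = borel]) auto
  moreover have "{\<omega> \<in> space M. a < sup_empirical_process f X \<Delta> n \<F> \<omega>} = V -` U \<inter> space M"
    by (auto simp: sup_empirical_process_def empirical_process_def U_def S_def V_def less_SUP_iff)
  ultimately show "{\<omega> \<in> space M. a < sup_empirical_process f X \<Delta> n \<F> \<omega>} \<in> sets M"
    by simp
qed

end

theory Submission
  imports Defs
begin

text \<open>The supremum of the empirical process is a function of the observations:
  \<open>sup\<^sub>\<phi> |\<nu>\<^sub>n(\<phi>)| = G(X\<^bsub>t\<^sub>1\<^esub>, \<dots>, X\<^bsub>t\<^sub>n\<^esub>)\<close> with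
  \<open>G v = sup\<^sub>\<phi> |1/n \<Sum>\<^sub>i (\<phi>(v\<^sub>i) - \<mm>(\<phi>))|\<close>. Moving \<open>v\<close> changes each average by at most
  \<open>c\<^sub>\<F>/n\<close> times the \<open>d\<^sub>1\<close>-displacement, uniformly in \<open>\<phi>\<close>, because the centring \<open>\<mm>(\<phi>)\<close> cancels. Hence
  \<open>G\<close> is Lipschitz with constant \<open>c\<^sub>\<F>/n\<close>, and the concentration inequality applies to it
  directly. The factor \<open>1/n\<^sup>2\<close> coming from the squared Lipschitz constant turns
  \<open>n powr aH H\<close> into \<open>n powr (- bH H)\<close>, since \<open>aH H + bH H = 2\<close>, which gives the rate
  \<open>(n \<Delta>) powr bH H\<close>.

  The one delicate point is that \<open>G\<close> must be real valued, although nothing bounds the class \<open>\<F>\<close>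
  pointwise. A real \<open>h\<close> above the expectation of the supremum makes that supremum
  finite for at least one outcome, and the uniform oscillation bound spreads finiteness from
  one point of the observation space to all of them
  (\<open>sup_centred_average_le\<close>, \<open>enn2real_sup_centred_average_Lipschitz\<close>).\<close>

section \<open>The best Lipschitz constant\<close>

lemma Lip_seminorm_le:
  assumes "0 \<le> L"
    and "\<And>x y. x \<in> mspace m1 \<Longrightarrow> y \<in> mspace m1 \<Longrightarrow> mdist m2 (g x) (g y) \<le> L * mdist m1 x y"
  shows "Lip_seminorm m1 m2 g \<le> L"
  unfolding Lip_seminorm_def by (rule cInf_lower) (use assms in \<open>auto intro: bdd_belowI[of _ 0]\<close>)

text \<open>The infimum is itself an admissible constant: dividing by a positive distance shows that the
  difference quotient is a lower bound of all admissible constants. The Lipschitz hypothesis makes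
  the set of these constants nonempty.\<close>

lemma
  assumes "Lipschitz_continuous_map m1 m2 g"
  shows Lip_seminorm_nonneg: "0 \<le> Lip_seminorm m1 m2 g"
    and mdist_le_Lip_seminorm:
      "x \<in> mspace m1 \<Longrightarrow> y \<in> mspace m1 \<Longrightarrow>
        mdist m2 (g x) (g y) \<le> Lip_seminorm m1 m2 g * mdist m1 x y"
proof -
  define S where
    "S = {L. 0 \<le> L \<and> (\<forall>x\<in>mspace m1. \<forall>y\<in>mspace m1. mdist m2 (g x) (g y) \<le> L * mdist m1 x y)}"
  have ne: "S \<noteq> {}"
    using assms unfolding Lipschitz_continuous_map_pos S_def by (auto intro: less_imp_le)
  have eq: "Lip_seminorm m1 m2 g = Inf S"
    by (simp add: Lip_seminorm_def S_def)
  show "0 \<le> Lip_seminorm m1 m2 g"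
    unfolding eq by (rule cInf_greatest[OF ne]) (simp add: S_def)
  assume xy: "x \<in> mspace m1" "y \<in> mspace m1"
  show "mdist m2 (g x) (g y) \<le> Lip_seminorm m1 m2 g * mdist m1 x y"
  proof (cases "mdist m1 x y = 0")
    case True
    obtain L where "mdist m2 (g x) (g y) \<le> L * mdist m1 x y"
      using ne xy by (auto simp: S_def)
    then show ?thesis
      by (simp only: True mult_zero_right)
  next
    case False
    then have pos: "0 < mdist m1 x y"
      using mdist_nonneg[of m1 x y] by linarith
    have "mdist m2 (g x) (g y) / mdist m1 x y \<le> Inf S"
      by (rule cInf_greatest[OF ne]) (use pos xy in \<open>simp add: S_def divide_le_eq\<close>)
    then show ?thesis
      using pos by (simp add: eq divide_le_eq)
  qed
qed

lemma Lip_sup_finite_imp_uniformly_Lipschitz: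
  fixes \<phi> :: "real \<Rightarrow> real"
  assumes "\<forall>\<phi>\<in>\<F>. Lipschitz_continuous_map euclidean_metric euclidean_metric \<phi>"
    and "Lip_sup \<F> < \<infinity>" and \<phi>: "\<phi> \<in> \<F>"
  shows "\<bar>\<phi> x - \<phi> y\<bar> \<le> enn2real (Lip_sup \<F>) * \<bar>x - y\<bar>"
proof -
  let ?L = "Lip_seminorm euclidean_metric euclidean_metric \<phi>"
  have "ennreal ?L \<le> Lip_sup \<F>"
    unfolding Lip_sup_def by (rule SUP_upper[OF \<phi>])
  then have "enn2real (ennreal ?L) \<le> enn2real (Lip_sup \<F>)"
    by (rule enn2real_mono) (use assms(2) in simp)
  then have L: "?L \<le> enn2real (Lip_sup \<F>)"
    using Lip_seminorm_nonneg assms(1) \<phi> by fastforce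
  have "\<bar>\<phi> x - \<phi> y\<bar> \<le> ?L * \<bar>x - y\<bar>"
    using mdist_le_Lip_seminorm[of euclidean_metric euclidean_metric \<phi> x y] assms(1) \<phi>
    by (simp add: dist_real_def)
  also have "\<dots> \<le> enn2real (Lip_sup \<F>) * \<bar>x - y\<bar>"
    using L by (rule mult_right_mono) simp
  finally show ?thesis .
qed

section \<open>The supremum as a function of the observations\<close>

definition sup_centred_average ::
    "((real \<Rightarrow> real) \<Rightarrow> real) \<Rightarrow> nat \<Rightarrow> (real \<Rightarrow> real) set \<Rightarrow> (nat \<Rightarrow> real) \<Rightarrow> ennreal" where
  "sup_centred_average m n \<F> v =
     (SUP \<phi>\<in>\<F>. ennreal \<bar>1 / real n * (\<Sum>i=1..n. \<phi> (v i) - m \<phi>)\<bar>)"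

lemma sup_empirical_process_eq:
  "sup_empirical_process f X \<Delta> n \<F> \<omega> =
     sup_centred_average (mean_wrt f) n \<F> (\<lambda>i\<in>{1..n}. X (real i * \<Delta> n) \<omega>)"
  by (simp add: sup_empirical_process_def empirical_process_def sup_centred_average_def)

text \<open>The bound holds with values in \<open>[0,\<infinity>]\<close>, so it transports finiteness from \<open>w\<close> to \<open>v\<close> as
  well as comparing finite values.\<close>

lemma sup_centred_average_le:
  assumes Lip: "\<And>\<phi> x y. \<phi> \<in> \<F> \<Longrightarrow> \<bar>\<phi> x - \<phi> y\<bar> \<le> K * \<bar>x - y\<bar>"
  shows "sup_centred_average m n \<F> v \<le>
    sup_centred_average m n \<F> w + ennreal (K / real n * (\<Sum>i=1..n. \<bar>v i - w i\<bar>))"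
    (is "_ \<le> _ + ennreal ?d")
  unfolding sup_centred_average_def[of m n \<F> v]
proof (rule SUP_least)
  fix \<phi> assume \<phi>: "\<phi> \<in> \<F>"
  let ?A = "\<lambda>u. 1 / real n * (\<Sum>i=1..n. \<phi> (u i) - m \<phi>)"
  have "?A v - ?A w = 1 / real n * (\<Sum>i=1..n. \<phi> (v i) - \<phi> (w i))"
    by (simp add: sum_subtractf right_diff_distrib)
  then have "\<bar>?A v - ?A w\<bar> = 1 / real n * \<bar>\<Sum>i=1..n. \<phi> (v i) - \<phi> (w i)\<bar>"
    by (simp add: abs_mult)
  also have "\<dots> \<le> 1 / real n * (\<Sum>i=1..n. K * \<bar>v i - w i\<bar>)"
    by (intro mult_left_mono order_trans[OF sum_abs] sum_mono Lip \<phi>) simp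
  also have "\<dots> = ?d"
    by (simp add: sum_distrib_left)
  finally have d: "\<bar>?A v - ?A w\<bar> \<le> ?d" .
  then have "ennreal \<bar>?A v\<bar> \<le> ennreal (\<bar>?A w\<bar> + ?d)"
    by (intro ennreal_leI) linarith
  also have "\<dots> = ennreal \<bar>?A w\<bar> + ennreal ?d"
    using d by (intro ennreal_plus) linarith+
  also have "\<dots> \<le> sup_centred_average m n \<F> w + ennreal ?d"
    unfolding sup_centred_average_def by (intro add_right_mono SUP_upper2[OF \<phi>] order_refl)
  finally show "ennreal \<bar>?A v\<bar> \<le> sup_centred_average m n \<F> w + ennreal ?d" .
qed

lemma sup_centred_average_finite:
  assumes "\<And>\<phi> x y. \<phi> \<in> \<F> \<Longrightarrow> \<bar>\<phi> x - \<phi> y\<bar> \<le> K * \<bar>x - y\<bar>"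
    and "sup_centred_average m n \<F> w < \<infinity>"
  shows "sup_centred_average m n \<F> v < \<infinity>"
  using sup_centred_average_le[of \<F> K m n v w] assms by (auto simp: order_le_less_trans)

lemma enn2real_sup_centred_average_Lipschitz:
  assumes Lip: "\<And>\<phi> x y. \<phi> \<in> \<F> \<Longrightarrow> \<bar>\<phi> x - \<phi> y\<bar> \<le> K * \<bar>x - y\<bar>" and K: "0 \<le> K"
    and fin: "sup_centred_average m n \<F> v\<^sub>0 < \<infinity>"
  defines "G \<equiv> \<lambda>v. enn2real (sup_centred_average m n \<F> v)"
  shows "Lipschitz_continuous_map (d1_metric n) euclidean_metric G"
    and "Lip_seminorm (d1_metric n) euclidean_metric G \<le> K / real n"
proof -
  have G_nonneg: "0 \<le> G v" for v
    by (simp add: G_def)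
  have le: "G v \<le> G w + K / real n * (\<Sum>i=1..n. \<bar>v i - w i\<bar>)" (is "_ \<le> _ + ?d") for v w
  proof -
    have d: "0 \<le> ?d"
      using K by (simp add: sum_nonneg)
    have w: "sup_centred_average m n \<F> w = ennreal (G w)"
      using sup_centred_average_finite[OF Lip fin] by (simp add: G_def)
    have "sup_centred_average m n \<F> v \<le> ennreal (G w + ?d)"
      using sup_centred_average_le[of \<F> K m n v w] Lip d
      by (simp add: w ennreal_plus G_nonneg)
    then show ?thesis
      unfolding G_def using G_nonneg[of w] d by (intro enn2real_leI) simp_all
  qed
  have dist: "mdist euclidean_metric (G v) (G w) \<le> K / real n * mdist (d1_metric n) v w" for v w
    using le[of v w] le[of w v] by (simp add: dist_real_def abs_le_iff abs_minus_commute)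
  show "Lipschitz_continuous_map (d1_metric n) euclidean_metric G"
    unfolding Lipschitz_continuous_map_def using dist by (intro conjI exI[of _ "K / real n"]) auto
  show "Lip_seminorm (d1_metric n) euclidean_metric G \<le> K / real n"
    by (rule Lip_seminorm_le) (use K dist in auto)
qed

section \<open>The rate of concentration\<close>

text \<open>Squaring the Lipschitz constant \<open>K/n\<close> leaves the exponent \<open>aH H - 2 = - bH H\<close> on \<open>n\<close>.\<close>

lemma concentration_rate:
  assumes "0 < n" "0 < \<delta>"
  shows "(K / n)\<^sup>2 * n powr aH H * \<delta> powr (- bH H) = K\<^sup>2 / (n * \<delta>) powr bH H"
proof -
  have "aH H = 2 - bH H"
    by (auto simp: aH_def bH_def)
  then have "n powr aH H = n\<^sup>2 / n powr bH H"
    using assms by (simp add: powr_diff)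
  then show ?thesis
    using assms by (simp add: powr_mult powr_minus power_divide field_simps)
qed

lemma concentration_bound_mono:
  assumes "0 < c" "0 < n" "0 < \<delta>" "0 < L" "L \<le> K / n"
  shows "exp (- (r\<^sup>2 / (c * L\<^sup>2 * n powr aH H * \<delta> powr (- bH H))))
    \<le> exp (- (r\<^sup>2 / (c * K\<^sup>2) * (n * \<delta>) powr bH H))"
proof -
  have "0 < c * L\<^sup>2 * n powr aH H * \<delta> powr (- bH H)"
    using assms by simp
  moreover have "c * L\<^sup>2 * n powr aH H * \<delta> powr (- bH H)
      \<le> c * (K / n)\<^sup>2 * n powr aH H * \<delta> powr (- bH H)"
    using assms by (intro mult_right_mono mult_left_mono power_mono) auto
  ultimately have "r\<^sup>2 / (c * (K / n)\<^sup>2 * n powr aH H * \<delta> powr (- bH H))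
      \<le> r\<^sup>2 / (c * L\<^sup>2 * n powr aH H * \<delta> powr (- bH H))"
    by (intro divide_left_mono) auto
  moreover have "c * (K / n)\<^sup>2 * n powr aH H * \<delta> powr (- bH H) = c * (K\<^sup>2 / (n * \<delta>) powr bH H)"
    using concentration_rate[OF assms(2,3), of K H] by (simp add: mult.assoc)
  ultimately show ?thesis
    by simp
qed

section \<open>Concentration of the supremum\<close>

theorem corollary2p6:
  fixes M :: "'a measure"
    and B X :: "real \<Rightarrow> 'a \<Rightarrow> real"
    and b f :: "real \<Rightarrow> real"
    and H \<sigma> m\<^sub>b c :: real
    and \<Delta> :: "nat \<Rightarrow> real"
    and \<F> :: "(real \<Rightarrow> real) set"
  assumes "prob_space M"
    and H: "0 < H" "H < 1"
    and \<sigma>: "\<sigma> \<noteq> 0"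
    and fBm: "fractional_brownian_motion M H B"
    and b: "b C1_differentiable_on UNIV"
    and b_bdd: "bounded (range (deriv b))"
    and m\<^sub>b: "0 < m\<^sub>b" "\<forall>x. deriv b x \<le> - m\<^sub>b"
    and X_sol: "solves_sde M b \<sigma> B X"
    and X_stat: "stationary_process M X"
    and f: "distributed M lborel (X 0) (\<lambda>x. ennreal (f x))" "\<forall>x. 0 \<le> f x"
    and f_L2: "integrable lborel (\<lambda>x. (f x)\<^sup>2)"
    and \<Delta>_pos: "\<forall>n\<ge>1. 0 < \<Delta> n"
    and \<Delta>_lim: "\<Delta> \<longlonglongrightarrow> 0"
    and n\<Delta>_lim: "filterlim (\<lambda>n. real n * \<Delta> n) at_top sequentially"
    and c: "concentration_constant M X H \<Delta> c"
    and \<F>_Lip: "\<forall>\<phi>\<in>\<F>. Lipschitz_continuous_map euclidean_metric euclidean_metric \<phi>"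
    and \<F>_bdd: "Lip_sup \<F> < \<infinity>"
  shows "\<forall>n\<ge>1. \<forall>h r :: real.
    ereal h \<ge> enn2ereal (\<integral>\<^sup>+ \<omega>. sup_empirical_process f X \<Delta> n \<F> \<omega> \<partial>M) \<longrightarrow> 0 < r \<longrightarrow>
    measure M {\<omega> \<in> space M. enn2ereal (sup_empirical_process f X \<Delta> n \<F> \<omega>) - ereal h > ereal r}
      \<le> (let c\<^sub>\<F> = enn2real (Lip_sup \<F>)
         in if c\<^sub>\<F> = 0 then 0
            else exp (- (r\<^sup>2 / (c * c\<^sub>\<F>\<^sup>2) * (real n * \<Delta> n) powr bH H)))"
proof (intro allI impI)
  fix n :: nat and h r :: real
  assume n: "1 \<le> n"
    and h: "ereal h \<ge> enn2ereal (\<integral>\<^sup>+ \<omega>. sup_empirical_process f X \<Delta> n \<F> \<omega> \<partial>M)"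
    and r: "0 < r"
  interpret prob_space M by fact
  define K where "K = enn2real (Lip_sup \<F>)"
  define G where "G v = enn2real (sup_centred_average (mean_wrt f) n \<F> v)" for v
  define L where "L = Lip_seminorm (d1_metric n) euclidean_metric G"
  define S where "S = sup_empirical_process f X \<Delta> n \<F>"
  define Z where "Z \<omega> = enn2real (S \<omega>)" for \<omega>
  have \<Delta>: "0 < \<Delta> n" and c_pos: "0 < c"
    using \<Delta>_pos n c by (auto simp: concentration_constant_def)
  have K: "0 \<le> K"
    by (simp add: K_def)
  have Lip: "\<bar>\<phi> x - \<phi> y\<bar> \<le> K * \<bar>x - y\<bar>" if "\<phi> \<in> \<F>" for \<phi> x y
    unfolding K_def using Lip_sup_finite_imp_uniformly_Lipschitz[OF \<F>_Lip \<F>_bdd that] .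
  have S_meas [measurable]: "S \<in> borel_measurable M"
    unfolding S_def using X_stat \<Delta> \<F>_Lip
    by (intro sup_empirical_process_measurable) (auto simp: stationary_process_def)
  have h_fin: "(\<integral>\<^sup>+ \<omega>. S \<omega> \<partial>M) < \<infinity>"
    using h by (cases "\<integral>\<^sup>+ \<omega>. S \<omega> \<partial>M") (auto simp: S_def)
  then have "AE \<omega> in M. S \<omega> \<noteq> \<infinity>"
    by (intro nn_integral_PInf_AE) auto
  then obtain \<omega>\<^sub>0 where "S \<omega>\<^sub>0 \<noteq> \<infinity>"
    using eventually_happens[OF \<open>AE \<omega> in M. S \<omega> \<noteq> \<infinity>\<close>] ae_filter_bot by blast
  then have fin\<^sub>0: "sup_centred_average (mean_wrt f) n \<F> (\<lambda>i\<in>{1..n}. X (real i * \<Delta> n) \<omega>\<^sub>0) < \<infinity>"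
    by (simp add: S_def sup_empirical_process_eq less_top)
  have S_eq: "S \<omega> = ennreal (Z \<omega>)" for \<omega>
    using sup_centred_average_finite[OF Lip fin\<^sub>0]
    by (simp add: S_def Z_def sup_empirical_process_eq)
  have Z_nonneg: "0 \<le> Z \<omega>" for \<omega>
    by (simp add: Z_def)
  have EZ: "(\<integral>\<omega>. Z \<omega> \<partial>M) \<le> h"
  proof -
    have "(\<integral>\<omega>. Z \<omega> \<partial>M) = enn2real (\<integral>\<^sup>+ \<omega>. S \<omega> \<partial>M)"
      unfolding S_eq by (rule integral_eq_nn_integral) (auto simp: Z_def[abs_def])
    also have "\<dots> \<le> h"
      using h h_fin by (cases "\<integral>\<^sup>+ \<omega>. S \<omega> \<partial>M") (auto simp: S_def)
    finally show ?thesis .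
  qed
  have G_Lip: "Lipschitz_continuous_map (d1_metric n) euclidean_metric G"
    and L_le: "L \<le> K / real n"
    unfolding L_def G_def using enn2real_sup_centred_average_Lipschitz[OF Lip K fin\<^sub>0] by auto
  have Z_eq: "Z = (\<lambda>\<omega>. G (\<lambda>i\<in>{1..n}. X (real i * \<Delta> n) \<omega>))"
    by (simp add: Z_def[abs_def] G_def S_def sup_empirical_process_eq)
  have "{\<omega> \<in> space M. enn2ereal (S \<omega>) - ereal h > ereal r}
      \<subseteq> {\<omega> \<in> space M. Z \<omega> - (\<integral>\<omega>'. Z \<omega>' \<partial>M) > r}"
    using EZ Z_nonneg by (auto simp: S_eq)
  moreover have "{\<omega> \<in> space M. Z \<omega> - (\<integral>\<omega>'. Z \<omega>' \<partial>M) > r} \<in> sets M"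
    unfolding Z_def by measurable
  ultimately have "measure M {\<omega> \<in> space M. enn2ereal (S \<omega>) - ereal h > ereal r}
      \<le> measure M {\<omega> \<in> space M. Z \<omega> - (\<integral>\<omega>'. Z \<omega>' \<partial>M) > r}"
    by (rule finite_measure_mono)
  also have "\<dots> \<le> (if L = 0 then 0
      else exp (- (r\<^sup>2 / (c * L\<^sup>2 * real n powr aH H * \<Delta> n powr (- bH H)))))"
    using c n r G_Lip unfolding concentration_constant_def Let_def Z_eq L_def by blast
  also have "\<dots> \<le> (if K = 0 then 0
      else exp (- (r\<^sup>2 / (c * K\<^sup>2) * (real n * \<Delta> n) powr bH H)))"
  proof -
    have L: "0 \<le> L" "L \<le> K / real n"
      using Lip_seminorm_nonneg[OF G_Lip] L_le by (auto simp: L_def)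
    consider "L = 0" | "0 < L" "K \<noteq> 0"
      using L by fastforce
    then show ?thesis
    proof cases
      case 2
      then show ?thesis
        using concentration_bound_mono[of c "real n" "\<Delta> n" L K r H] c_pos n \<Delta> L by simp
    qed simp
  qed
  finally show "measure M {\<omega> \<in> space M.
        enn2ereal (sup_empirical_process f X \<Delta> n \<F> \<omega>) - ereal h > ereal r}
      \<le> (let c\<^sub>\<F> = enn2real (Lip_sup \<F>)
         in if c\<^sub>\<F> = 0 then 0
            else exp (- (r\<^sup>2 / (c * c\<^sub>\<F>\<^sup>2) * (real n * \<Delta> n) powr bH H)))"
    unfolding S_def K_def Let_def .
qed

end
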